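(* Let $j\in\{1,2,3,4\}$, and consider the sphere $\Sigma_{0,4-j,j}$ with $4-j$ holes and $j$ orbifold points, with shear coordinates, Poisson bracket and generators $\gamma_1,\gamma_2,\gamma_3$ of its Fuchsian group as in the context. The Poisson algebra of geodesic functions on $\Sigma_{0,4-j,j}$ is generated, over the central elements $G_1,G_2,G_3,G_\infty$, by the three elements $$G_{i,j}:=-\mathrm{Tr}(\gamma_i\gamma_j),\qquad 1\le i<j\le 3,$$ that is, by $G_{1,2},G_{1,3},G_{2,3}$, and their Poisson brackets are $$\{G_{1,2},G_{2,3}\}=G_{1,2}G_{2,3}-2G_{1,3}-\omega_{1,3},$$ $$\{G_{2,3},G_{1,3}\}=G_{2,3}G_{1,3}-2G_{1,2}-\omega_{1,2},$$ $$\{G_{1,3},G_{1,2}\}=G_{1,2}G_{1,3}-2G_{2,3}-\omega_{2,3},$$ where $\omega_{i,j}=G_iG_j+G_kG_\infty$ for $\{i,j,k\}=\{1,2,3\}$, $G_i=-\mathrm{Tr}(\gamma_i)$ and $G_\infty=-\mathrm{Tr}(\gamma_1\gamma_2\gamma_3)$.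
   Context: Matrices: $R=\begin{pmatrix}1&1\\ -1&0\end{pmatrix}$, $L=\begin{pmatrix}0&1\\ -1&-1\end{pmatrix}$, $X_Z=\begin{pmatrix}0&-e^{Z/2}\\ e^{-Z/2}&0\end{pmatrix}$. The four distinguished points of the sphere are numbered $1,2,3,\infty$; each is either a hole with perimeter $P$, or an orbifold point of order $k$, the latter corresponding formally to an imaginary perimeter $P=2\pi i/k$. The coordinates are $Y_1,Y_2,Y_3$, together with $P_i$ for each hole $i\in\{1,2,3\}$. The bracket is determined by $\{Y_1,Y_2\}=\{Y_2,Y_3\}=\{Y_3,Y_1\}=1$, and the $P_i$ are central. Generators of the Fuchsian group: $$\gamma_1=B_1,\qquad \gamma_2=-RB_2L,\qquad \gamma_3=-LB_3R,$$ where for $i\in\{1,2,3\}$: - if $i$ is a hole, $B_i=X_{Y_i}RX_{P_i}RX_{Y_i}$; this equals $\begin{pmatrix}0&-e^{\widetilde Y_i}\\ e^{-\widetilde Y_i}&-G_i\end{pmatrix}$ with $\widetilde Y_i=Y_i+P_i/2$ and $G_i=e^{P_i/2}+e^{-P_i/2}$; - if $i$ is an orbifold point of order $k_i$, $B_i=X_{Y_i}F_iX_{Y_i}$ with $F_i=\begin{pmatrix}G_i&1\\ -1&0\end{pmatrix}$ and $G_i=2\cos(\pi/k_i)$; this equals $\begin{pmatrix}0&-e^{Y_i}\\ e^{-Y_i}&-G_i\end{pmatrix}$. The fourth point $\infty$ enters only through the central function $G_\infty=-\mathrm{Tr}(\gamma_1\gamma_2\gamma_3)$; when it is an orbifold point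 of order $k$ the coordinates $Y_i$ are formally complexified so that $G_\infty$ takes the value $2\cos(\pi/k)$. The geodesic function of a closed geodesic corresponding to a group element $\gamma$ is $e^{\ell_\gamma/2}+e^{-\ell_\gamma/2}$, where $\ell_\gamma$ is the length of the geodesic, equal to $\mathrm{Tr}\,\gamma$ up to sign. The algebra of geodesic functions is the algebra generated by all functions $\mathrm{Tr}\,\gamma$, with $\gamma$ in the group generated by $\gamma_1,\gamma_2,\gamma_3$, with the Poisson bracket determined by $\{Y_1,Y_2\}=\{Y_2,Y_3\}=\{Y_3,Y_1\}=1$ and the $P_i$ being central. *)

theory Defs
  imports "HOL-Analysis.Analysis"
begin

text \<open>
  The scalar type \<open>'a\<close> is \<open>real\<close> for the actual shear coordinates and \<open>complex\<close> when
  the \<open>Y\<^sub>i\<close> are complexified, which is needed when the fourth point is an orbifold point.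
  Holes have no further datum: their perimeters are coordinates.
\<close>

datatype marked_point = Hole | Orbifold nat

fun is_orbifold :: "marked_point \<Rightarrow> bool" where
  "is_orbifold Hole = False"
| "is_orbifold (Orbifold k) = True"

fun valid_point :: "marked_point \<Rightarrow> bool" where
  "valid_point Hole = True"
| "valid_point (Orbifold k) = (k \<ge> 2)"

definition num_orbifold :: "(3 \<Rightarrow> marked_point) \<Rightarrow> marked_point \<Rightarrow> nat" where
  "num_orbifold c c_inf = card {i. is_orbifold (c i)} + (if is_orbifold c_inf then 1 else 0)"

text \<open>
  A point \<open>(Y, P)\<close>. The entry \<open>P $ i\<close> is a coordinate only if \<open>i\<close> is a hole; otherwise
  it is unused and is pinned to \<open>0\<close> in \<open>phase_space\<close> below.
\<close>

type_synonym 'a coords = "('a ^ 3) \<times> (real ^ 3)"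

definition mat2 :: "'a::zero \<Rightarrow> 'a \<Rightarrow> 'a \<Rightarrow> 'a \<Rightarrow> 'a ^ 2 ^ 2" where
  "mat2 a b c d = vector [vector [a, b], vector [c, d]]"

definition R_mat :: "'a::comm_ring_1 ^ 2 ^ 2" where
  "R_mat = mat2 1 1 (- 1) 0"

definition L_mat :: "'a::comm_ring_1 ^ 2 ^ 2" where
  "L_mat = mat2 0 1 (- 1) (- 1)"

definition X_mat :: "'a::{banach, real_normed_field} \<Rightarrow> 'a ^ 2 ^ 2" where
  "X_mat z = mat2 0 (- exp (z / 2)) (exp (- z / 2)) 0"

definition F_mat :: "nat \<Rightarrow> 'a::{banach, real_normed_field} ^ 2 ^ 2" where
  "F_mat k = mat2 (of_real (2 * cos (pi / real k))) 1 (- 1) 0"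

definition B_mat ::
  "(3 \<Rightarrow> marked_point) \<Rightarrow> 3 \<Rightarrow> 'a::{banach, real_normed_field} coords \<Rightarrow> 'a ^ 2 ^ 2" where
  "B_mat c i p =
     (case c i of
        Hole \<Rightarrow>
          X_mat (fst p $ i) ** R_mat ** X_mat (of_real (snd p $ i)) ** R_mat ** X_mat (fst p $ i)
      | Orbifold k \<Rightarrow> X_mat (fst p $ i) ** F_mat k ** X_mat (fst p $ i))"

text \<open>
  In the index type \<open>3\<close> the numerals are taken modulo 3, so its elements are \<open>1\<close>, \<open>2\<close> and
  \<open>3 = 0\<close>, and its order is not the one of the labels. The last branch is the index \<open>3\<close>.
\<close>

definition \<gamma> ::
  "(3 \<Rightarrow> marked_point) \<Rightarrow> 3 \<Rightarrow> 'a::{banach, real_normed_field} coords \<Rightarrow> 'a ^ 2 ^ 2" where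
  "\<gamma> c i p =
     (if i = 1 then B_mat c 1 p
      else if i = 2 then - (R_mat ** B_mat c 2 p ** L_mat)
      else - (L_mat ** B_mat c 3 p ** R_mat))"

text \<open>Group elements are matrix-valued functions of the coordinates.\<close>

inductive_set fuchsian_group ::
  "(3 \<Rightarrow> marked_point) \<Rightarrow> ('a::{banach, real_normed_field} coords \<Rightarrow> 'a ^ 2 ^ 2) set"
  for c :: "3 \<Rightarrow> marked_point" where
  one: "(\<lambda>p. mat 1) \<in> fuchsian_group c"
| generator: "\<gamma> c i \<in> fuchsian_group c"
| inverse: "g \<in> fuchsian_group c \<Longrightarrow> (\<lambda>p. matrix_inv (g p)) \<in> fuchsian_group c"
| mult: "g \<in> fuchsian_group c \<Longrightarrow> h \<in> fuchsian_group c \<Longrightarrow> (\<lambda>p. g p ** h p) \<in> fuchsian_group c"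

definition G_pt ::
  "(3 \<Rightarrow> marked_point) \<Rightarrow> 3 \<Rightarrow> 'a::{banach, real_normed_field} coords \<Rightarrow> 'a" where
  "G_pt c i p = - trace (\<gamma> c i p)"

definition G_pair ::
  "(3 \<Rightarrow> marked_point) \<Rightarrow> 3 \<Rightarrow> 3 \<Rightarrow> 'a::{banach, real_normed_field} coords \<Rightarrow> 'a" where
  "G_pair c i j p = - trace (\<gamma> c i p ** \<gamma> c j p)"

definition G_inf ::
  "(3 \<Rightarrow> marked_point) \<Rightarrow> 'a::{banach, real_normed_field} coords \<Rightarrow> 'a" where
  "G_inf c p = - trace (\<gamma> c 1 p ** \<gamma> c 2 p ** \<gamma> c 3 p)"

text \<open>The third argument of \<open>\<omega>\<close> is the index complementary to the first two.\<close>

definition \<omega> ::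
  "(3 \<Rightarrow> marked_point) \<Rightarrow> 3 \<Rightarrow> 3 \<Rightarrow> 3 \<Rightarrow> 'a::{banach, real_normed_field} coords \<Rightarrow> 'a" where
  "\<omega> c i j k p = G_pt c i p * G_pt c j p + G_pt c k p * G_inf c p"

text \<open>
  If the fourth point is an orbifold point, the coordinates range over a level set of
  \<open>G_inf c\<close>. Over \<open>real\<close> that level set is empty, so then only \<open>complex\<close> is of interest.
\<close>

definition phase_space ::
  "(3 \<Rightarrow> marked_point) \<Rightarrow> marked_point \<Rightarrow> 'a::{banach, real_normed_field} coords set" where
  "phase_space c c_inf =
     {p. (\<forall>i. is_orbifold (c i) \<longrightarrow> snd p $ i = 0) \<and>
         (case c_inf of
            Hole \<Rightarrow> True
          | Orbifold k \<Rightarrow> G_inf c p = of_real (2 * cos (pi / real k)))}"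

definition partial_Y ::
  "3 \<Rightarrow> ('a::{banach, real_normed_field} coords \<Rightarrow> 'a) \<Rightarrow> 'a coords \<Rightarrow> 'a" where
  "partial_Y i f p = deriv (\<lambda>t. f (\<chi> l. if l = i then t else fst p $ l, snd p)) (fst p $ i)"

text \<open>
  The bracket with \<open>{Y\<^sub>1,Y\<^sub>2} = {Y\<^sub>2,Y\<^sub>3} = {Y\<^sub>3,Y\<^sub>1} = 1\<close> and central \<open>P\<^sub>i\<close>, written in the
  coordinates; hence there are no derivatives in the direction of \<open>P\<close>.
\<close>

definition poisson ::
  "('a::{banach, real_normed_field} coords \<Rightarrow> 'a) \<Rightarrow> ('a coords \<Rightarrow> 'a) \<Rightarrow> 'a coords \<Rightarrow> 'a" where
  "poisson f g p =
     (partial_Y 1 f p * partial_Y 2 g p - partial_Y 2 f p * partial_Y 1 g p) +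
     (partial_Y 2 f p * partial_Y 3 g p - partial_Y 3 f p * partial_Y 2 g p) +
     (partial_Y 3 f p * partial_Y 1 g p - partial_Y 1 f p * partial_Y 3 g p)"

inductive_set generated_algebra :: "('p \<Rightarrow> 'a::comm_ring_1) set \<Rightarrow> ('p \<Rightarrow> 'a) set"
  for S :: "('p \<Rightarrow> 'a) set" where
  const: "(\<lambda>p. a) \<in> generated_algebra S"
| base: "f \<in> S \<Longrightarrow> f \<in> generated_algebra S"
| add: "f \<in> generated_algebra S \<Longrightarrow> g \<in> generated_algebra S \<Longrightarrow> (\<lambda>p. f p + g p) \<in> generated_algebra S"
| mult: "f \<in> generated_algebra S \<Longrightarrow> g \<in> generated_algebra S \<Longrightarrow> (\<lambda>p. f p * g p) \<in> generated_algebra S"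

text \<open>
  The geodesic functions as functions of unconstrained coordinates. The functions on the surface
  are their restrictions to \<open>phase_space\<close>; the unconstrained version is kept because
  \<open>partial_Y\<close> differentiates in directions that may leave the level set.
\<close>

definition geodesic_functions ::
  "(3 \<Rightarrow> marked_point) \<Rightarrow> ('a::{banach, real_normed_field} coords \<Rightarrow> 'a) set" where
  "geodesic_functions c = generated_algebra {\<lambda>p. trace (g p) | g. g \<in> fuchsian_group c}"

definition restrict_all :: "'p set \<Rightarrow> ('p \<Rightarrow> 'a) set \<Rightarrow> ('p \<Rightarrow> 'a) set" where
  "restrict_all D A = (\<lambda>f. restrict f D) ` A"

end

theory Submission
  imports Defs
begin

text \<open>
  By the Cayley-Hamilton identity and its polarization, the span of the ordered products of
  \<open>\<gamma>\<^sub>1, \<gamma>\<^sub>2, \<gamma>\<^sub>3\<close> over the algebra generated by the seven \<open>G\<close>'s is stable under right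
  multiplication by the whole group, so every trace of a group element lies in that algebra.
  With \<open>a\<^sub>i = exp (Y\<^sub>i + P\<^sub>i / 2)\<close> the \<open>G\<close>'s are Laurent polynomials in \<open>a\<^sub>1, a\<^sub>2, a\<^sub>3\<close>, and
  \<open>G_inf = a\<^sub>1 a\<^sub>2 a\<^sub>3 + 1 / (a\<^sub>1 a\<^sub>2 a\<^sub>3)\<close>; the brackets follow by differentiation and the
  Leibniz rule. The bracket only sees differences of partial derivatives, that is, derivatives
  along directions with coordinate sum \<open>0\<close>; these are tangent to the level sets of \<open>G_inf\<close>, hence
  the bracket descends to functions on \<open>phase_space\<close>.
\<close>

section \<open>Traces of words in unimodular two-by-two matrices\<close>

lemma mat2_nth [simp]:
  "mat2 a b c d $ 1 $ 1 = a" "mat2 a b c d $ 1 $ 2 = b"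
  "mat2 a b c d $ 2 $ 1 = c" "mat2 a b c d $ 2 $ 2 = d"
  by (simp_all add: mat2_def)

lemma mat2_eq_iff:
  "M = mat2 a b c d \<longleftrightarrow> M $ 1 $ 1 = a \<and> M $ 1 $ 2 = b \<and> M $ 2 $ 1 = c \<and> M $ 2 $ 2 = d"
  by (auto simp: vec_eq_iff forall_2)

lemma mat2_mult:
  fixes a :: "'a::comm_ring_1"
  shows "mat2 a b c d ** mat2 a' b' c' d' =
    mat2 (a * a' + b * c') (a * b' + b * d') (c * a' + d * c') (c * b' + d * d')"
  by (simp add: mat2_eq_iff matrix_matrix_mult_def sum_2)

lemma mat2_uminus: "- mat2 a b c d = mat2 (- a) (- b) (- c) (- (d::'a::comm_ring_1))"
  by (simp add: mat2_eq_iff)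

lemma trace_mat2: "trace (mat2 a b c d) = a + (d::'a::comm_ring_1)"
  by (simp add: trace_def sum_2)

lemma det_mat2: "det (mat2 a b c d) = a * d - b * (c::'a::comm_ring_1)"
  by (simp add: det_2)

text \<open>Scalars act as scalar matrices \<open>mat k\<close> through \<open>**\<close>, so that
  associativity and distributivity of the matrix product also move scalars around.\<close>

lemma mat_mult_nth: "(mat k ** A) $ i $ j = k * (A :: 'a::semiring_1^'n^'m) $ i $ j"
proof -
  have "(mat k ** A) $ i $ j = (\<Sum>l\<in>UNIV. if i = l then k * A $ l $ j else 0)"
    unfolding matrix_matrix_mult_def vec_lambda_beta by (intro sum.cong) (auto simp: mat_def)
  then show ?thesis
    by simp
qed

lemma mult_mat_nth: "(A ** mat k) $ i $ j = (A :: 'a::semiring_1^'n^'m) $ i $ j * k"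
proof -
  have "(A ** mat k) $ i $ j = (\<Sum>l\<in>UNIV. if l = j then A $ i $ l * k else 0)"
    unfolding matrix_matrix_mult_def vec_lambda_beta by (intro sum.cong) (auto simp: mat_def)
  then show ?thesis
    by simp
qed

lemma trace_mat_mult: "trace (mat k ** A) = k * trace (A :: 'a::comm_ring_1^'n^'n)"
  by (simp add: trace_def mat_mult_nth sum_distrib_left)

lemma mat_commute: "A ** mat k = mat k ** (A :: 'a::comm_ring_1^'n^'n)"
  by (simp add: vec_eq_iff mat_mult_nth mult_mat_nth mult.commute)

lemma mat_add: "mat (a + b) = mat a + (mat b :: 'a::comm_ring_1^'n^'n)"
  by (simp add: vec_eq_iff mat_def)

lemma mat_mult_mat: "mat a ** mat b = (mat (a * b) :: 'a::comm_ring_1^'n^'n)"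
  by (simp add: vec_eq_iff mat_mult_nth) (simp add: mat_def)

section \<open>Cayley-Hamilton identities and unimodular inverses\<close>

lemma cayley_hamilton_2:
  fixes A :: "'a::comm_ring_1^2^2"
  shows "A ** A = mat (trace A) ** A + mat (- det A)"
  by (simp add: vec_eq_iff forall_2 matrix_matrix_mult_def sum_2 trace_def det_2 mat_def algebra_simps)

text \<open>Expanding Cayley-Hamilton for \<open>A + C\<close> and cancelling the squares leaves the
  mixed terms, solved here for \<open>C ** A\<close>; the scalar is the polarization of
  \<open>- det\<close>.\<close>

lemma polarized_cayley_hamilton_2:
  fixes A C :: "'a::comm_ring_1^2^2"
  shows "C ** A = mat (- 1) ** (A ** C) + mat (trace C) ** A + mat (trace A) ** C
    + mat (trace (A ** C) - trace A * trace C)"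
  by (simp add: vec_eq_iff forall_2 matrix_matrix_mult_def sum_2 trace_def mat_def algebra_simps)

lemma matrix_add_rdistrib:
  fixes A :: "'a::semiring_1^'n^'m"
  shows "(A + B) ** C = A ** C + B ** C"
  by (simp add: vec_eq_iff matrix_matrix_mult_def distrib_right sum.distrib)

text \<open>Cayley-Hamilton with determinant 1 reads
  \<open>A ** (mat (trace A) - A) = mat 1\<close>. The inverse is thus a polynomial in
  \<open>A\<close>, so stability of a module under \<open>A\<close> passes to the inverse once the
  trace is an admissible coefficient.\<close>

lemma matrix_inv_unimodular_2:
  fixes A :: "'a::field^2^2"
  assumes "det A = 1"
  shows "matrix_inv A = mat (trace A) + mat (- 1) ** A"
proof -
  let ?B = "mat (trace A) + mat (- 1) ** A"
  have "A ** ?B = mat (trace A) ** A + mat (- 1) ** (A ** A)"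
    by (simp only: matrix_add_ldistrib mat_commute matrix_mul_assoc)
  also have "\<dots> = mat 1"
    using assms by (simp add: cayley_hamilton_2[of A] vec_eq_iff mat_mult_nth) (simp add: mat_def)
  finally have right: "A ** ?B = mat 1" .
  then have left: "?B ** A = mat 1"
    using matrix_left_right_inverse by blast
  \<comment> \<open>\<open>matrix_inv\<close> chooses a two-sided inverse, so existence must come
    before its equations; uniqueness of inverses then identifies it with \<open>?B\<close>.\<close>
  have "\<exists>B. A ** B = mat 1 \<and> B ** A = mat 1"
    using left right by blast
  then have "A ** matrix_inv A = mat 1 \<and> matrix_inv A ** A = mat 1"
    unfolding matrix_inv_def by (rule someI_ex)
  then have "?B ** A ** matrix_inv A = ?B"
    by (simp only: matrix_mul_assoc[symmetric] matrix_mul_rid)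
  then show ?thesis
    by (simp only: left matrix_mul_lid)
qed

lemma det_matrix_inv_unimodular_2:
  fixes A :: "'a::field^2^2"
  assumes "det A = 1"
  shows "det (matrix_inv A) = 1"
proof -
  have "det (matrix_inv A) = det A"
    unfolding matrix_inv_unimodular_2[OF assms] det_2 vector_add_component mat_mult_nth
    by (simp add: mat_def trace_def sum_2 algebra_simps)
  then show ?thesis
    using assms by simp
qed

section \<open>Coefficient algebras and modules of matrix-valued functions\<close>

locale function_algebra =
  fixes T :: "('p \<Rightarrow> 'a::field) set"
  assumes const: "(\<lambda>p. a) \<in> T"
    and add: "f \<in> T \<Longrightarrow> g \<in> T \<Longrightarrow> (\<lambda>p. f p + g p) \<in> T"
    and mult: "f \<in> T \<Longrightarrow> g \<in> T \<Longrightarrow> (\<lambda>p. f p * g p) \<in> T"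
begin

lemma uminus: "f \<in> T \<Longrightarrow> (\<lambda>p. - f p) \<in> T"
  using mult[OF const[of "- 1"], of f] by simp

lemma diff: "f \<in> T \<Longrightarrow> g \<in> T \<Longrightarrow> (\<lambda>p. f p - g p) \<in> T"
  using add[OF _ uminus, of f g] by simp

lemma generated_algebra_subset:
  assumes "S \<subseteq> T"
  shows "generated_algebra S \<subseteq> T"
proof
  fix f assume "f \<in> generated_algebra S"
  then show "f \<in> T"
    by induction (rule const, erule subsetD[OF assms], erule (1) add, erule (1) mult)
qed

definition right_module :: "('p \<Rightarrow> 'a^2^2) set \<Rightarrow> ('p \<Rightarrow> 'a^2^2) set \<Rightarrow> bool" where
  "right_module N S \<longleftrightarrow>
    (\<forall>n\<in>N. \<forall>m\<in>N. (\<lambda>p. n p + m p) \<in> N) \<and>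
    (\<forall>t\<in>T. \<forall>n\<in>N. (\<lambda>p. mat (t p) ** n p) \<in> N) \<and>
    (\<forall>n\<in>N. \<forall>x\<in>S. (\<lambda>p. n p ** x p) \<in> N)"

text \<open>This is \<open>N + N x\<close>. Cayley-Hamilton removes higher powers of
  \<open>x\<close> whenever its determinant is 1 and its trace lies in \<open>T\<close>.\<close>

definition adjoin :: "('p \<Rightarrow> 'a^2^2) set \<Rightarrow> ('p \<Rightarrow> 'a^2^2) \<Rightarrow> ('p \<Rightarrow> 'a^2^2) set" where
  "adjoin N x = {\<lambda>p. n p + m p ** x p | n m. n \<in> N \<and> m \<in> N}"

lemma right_moduleD:
  assumes "right_module N S"
  shows "\<lbrakk>n \<in> N; m \<in> N\<rbrakk> \<Longrightarrow> (\<lambda>p. n p + m p) \<in> N"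
    and "\<lbrakk>t \<in> T; n \<in> N\<rbrakk> \<Longrightarrow> (\<lambda>p. mat (t p) ** n p) \<in> N"
    and "\<lbrakk>n \<in> N; y \<in> S\<rbrakk> \<Longrightarrow> (\<lambda>p. n p ** y p) \<in> N"
  using assms by (auto simp: right_module_def)

lemma adjoinI: "\<lbrakk>n \<in> N; m \<in> N; \<And>p. f p = n p + m p ** z p\<rbrakk> \<Longrightarrow> f \<in> adjoin N z"
  unfolding adjoin_def by (auto simp: fun_eq_iff)

lemma adjoinE:
  assumes "f \<in> adjoin N z"
  obtains n m where "n \<in> N" "m \<in> N" "f = (\<lambda>p. n p + m p ** z p)"
  using assms by (auto simp: adjoin_def)

text \<open>Products \<open>z y\<close> with \<open>y \<in> S\<close> are reordered into \<open>y z\<close> by the polarized Cayley-Hamilton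
  identity, at the cost of scalars in \<open>T\<close>.\<close>

lemma right_module_adjoin:
  assumes N: "right_module N S"
    and det: "\<And>p. det (z p) = 1" and tr: "(\<lambda>p. trace (z p)) \<in> T"
    and trS: "\<And>y. y \<in> S \<Longrightarrow> (\<lambda>p. trace (y p)) \<in> T \<and> (\<lambda>p. trace (y p ** z p)) \<in> T"
  shows "right_module (adjoin N z) (insert z S)"
proof -
  note plus = right_moduleD(1)[OF N] and scale = right_moduleD(2)[OF N]
    and right = right_moduleD(3)[OF N]
  have "(\<lambda>p. f p + g p) \<in> adjoin N z" if "f \<in> adjoin N z" "g \<in> adjoin N z" for f g
  proof -
    obtain n m where nm: "n \<in> N" "m \<in> N" and f: "f = (\<lambda>p. n p + m p ** z p)"
      using \<open>f \<in> _\<close> by (rule adjoinE)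
    obtain n' m' where nm': "n' \<in> N" "m' \<in> N" and g: "g = (\<lambda>p. n' p + m' p ** z p)"
      using \<open>g \<in> _\<close> by (rule adjoinE)
    show ?thesis
      by (rule adjoinI[OF plus[OF nm(1) nm'(1)] plus[OF nm(2) nm'(2)]])
        (simp add: f g matrix_add_rdistrib)
  qed
  moreover have "(\<lambda>p. mat (t p) ** f p) \<in> adjoin N z" if t: "t \<in> T" and "f \<in> adjoin N z" for f t
  proof -
    obtain n m where nm: "n \<in> N" "m \<in> N" and f: "f = (\<lambda>p. n p + m p ** z p)"
      using \<open>f \<in> _\<close> by (rule adjoinE)
    show ?thesis
      by (rule adjoinI[OF scale[OF t nm(1)] scale[OF t nm(2)]])
        (simp add: f matrix_add_ldistrib matrix_mul_assoc)
  qed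
  moreover have "(\<lambda>p. f p ** y p) \<in> adjoin N z" if "f \<in> adjoin N z" "y \<in> insert z S" for f y
  proof -
    obtain n m where n: "n \<in> N" and m: "m \<in> N" and f: "f = (\<lambda>p. n p + m p ** z p)"
      using \<open>f \<in> _\<close> by (rule adjoinE)
    show ?thesis
    proof (cases "y = z")
      case True
      show ?thesis
      proof (rule adjoinI)
        show "(\<lambda>p. mat (- 1) ** m p) \<in> N"
          using scale[OF const m] .
        show "(\<lambda>p. n p + mat (trace (z p)) ** m p) \<in> N"
          using plus[OF n scale[OF tr m]] .
        fix p
        have "f p ** y p = n p ** z p + m p ** (z p ** z p)"
          by (simp add: f True matrix_add_rdistrib matrix_mul_assoc)
        also have "\<dots> = n p ** z p + m p ** mat (trace (z p)) ** z p + m p ** mat (- 1)"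
          by (simp add: cayley_hamilton_2[of "z p"] det matrix_add_ldistrib matrix_mul_assoc add.assoc)
        also have "\<dots> = mat (- 1) ** m p + (n p + mat (trace (z p)) ** m p) ** z p"
          by (simp add: mat_commute matrix_add_rdistrib)
        finally show "f p ** y p = mat (- 1) ** m p + (n p + mat (trace (z p)) ** m p) ** z p" .
      qed
    next
      case False
      then have y: "y \<in> S"
        using that by simp
      let ?k = "\<lambda>p. trace (y p ** z p) - trace (y p) * trace (z p)"
      have k: "?k \<in> T"
        using trS[OF y] tr by (intro diff mult) auto
      \<comment> \<open>The two witnesses collect the terms free of \<open>z\<close> and the
        coefficients of a final \<open>z\<close>. After reordering, \<open>y\<close> follows
        \<open>n\<close> or \<open>m\<close> directly, where it is absorbed by
        \<open>N\<close>.\<close>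
      show ?thesis
      proof (rule adjoinI)
        show "(\<lambda>p. n p ** y p + (mat (trace (z p)) ** (m p ** y p) + mat (?k p) ** m p)) \<in> N"
          using plus[OF right[OF n y] plus[OF scale[OF tr right[OF m y]] scale[OF k m]]] .
        show "(\<lambda>p. mat (- 1) ** (m p ** y p) + mat (trace (y p)) ** m p) \<in> N"
          using plus[OF scale[OF const right[OF m y]] scale[OF conjunct1[OF trS[OF y]] m]] .
        fix p
        have "f p ** y p = n p ** y p + m p ** (z p ** y p)"
          by (simp add: f matrix_add_rdistrib matrix_mul_assoc)
        also have "m p ** (z p ** y p) =
          m p ** mat (- 1) ** y p ** z p + m p ** mat (trace (z p)) ** y p
          + m p ** mat (trace (y p)) ** z p + m p ** mat (?k p)"
          by (subst polarized_cayley_hamilton_2[of "z p" "y p"])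
            (simp only: matrix_add_ldistrib matrix_mul_assoc)
        finally show "f p ** y p =
          n p ** y p + (mat (trace (z p)) ** (m p ** y p) + mat (?k p) ** m p)
          + (mat (- 1) ** (m p ** y p) + mat (trace (y p)) ** m p) ** z p"
          by (simp only: mat_commute[of "m p"] matrix_add_rdistrib matrix_mul_assoc ac_simps)
      qed
    qed
  qed
  ultimately show ?thesis
    unfolding right_module_def by blast
qed

text \<open>By linearity, tr((n + m z) w) = tr(n w) + tr(m (z w)): the last adjoined letter moves
  into the test word \<open>w\<close>, and one layer of adjunction is removed.\<close>

lemma trace_adjoin:
  assumes "\<And>n. n \<in> N \<Longrightarrow> (\<lambda>p. trace (n p ** w p)) \<in> T"
    and "\<And>n. n \<in> N \<Longrightarrow> (\<lambda>p. trace (n p ** (z p ** w p))) \<in> T"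
    and "f \<in> adjoin N z"
  shows "(\<lambda>p. trace (f p ** w p)) \<in> T"
proof -
  obtain n m where "n \<in> N" "m \<in> N" "f = (\<lambda>p. n p + m p ** z p)"
    using assms(3) by (rule adjoinE)
  then show ?thesis
    using add[OF assms(1)[of n] assms(2)[of m]]
    by (simp add: matrix_add_rdistrib trace_add matrix_mul_assoc)
qed

lemma adjoin_subset:
  assumes "right_module N S"
  shows "N \<subseteq> adjoin N z"
proof
  fix n assume n: "n \<in> N"
  show "n \<in> adjoin N z"
    by (rule adjoinI[OF n right_moduleD(2)[OF assms const[of 0] n]])
      (simp add: vec_eq_iff mat_mult_nth flip: matrix_mul_assoc)
qed

text \<open>The module is the \<open>T\<close>-span of the eight ordered words 1, x, y, xy, z, xz,
  yz, xyz. Their traces are the constant 2 and the seven traces assumed to lie in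
  \<open>T\<close>.\<close>

lemma exists_trace_module:
  assumes det: "\<And>p. det (x p) = 1" "\<And>p. det (y p) = 1" "\<And>p. det (z p) = 1"
    and tr: "(\<lambda>p. trace (x p)) \<in> T" "(\<lambda>p. trace (y p)) \<in> T" "(\<lambda>p. trace (z p)) \<in> T"
      "(\<lambda>p. trace (x p ** y p)) \<in> T" "(\<lambda>p. trace (x p ** z p)) \<in> T"
      "(\<lambda>p. trace (y p ** z p)) \<in> T" "(\<lambda>p. trace (x p ** y p ** z p)) \<in> T"
  obtains N where "right_module N {x, y, z}" "(\<lambda>p. mat 1) \<in> N"
    "\<And>n. n \<in> N \<Longrightarrow> (\<lambda>p. trace (n p)) \<in> T"
proof -
  define N0 where "N0 = {\<lambda>p. mat (t p) :: 'a^2^2 | t. t \<in> T}"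
  define N where "N = adjoin (adjoin (adjoin N0 x) y) z"
  have N0I: "(\<lambda>p. mat (t p)) \<in> N0" if "t \<in> T" for t
    using that unfolding N0_def by auto
  have N0E: "\<exists>t\<in>T. n = (\<lambda>p. mat (t p))" if "n \<in> N0" for n
    using that unfolding N0_def by auto
  have "(\<lambda>p. n p + m p) \<in> N0" if "n \<in> N0" "m \<in> N0" for n m
    using N0E[OF that(1)] N0E[OF that(2)] N0I[OF add] by (auto simp: mat_add)
  moreover have "(\<lambda>p. mat (t p) ** n p) \<in> N0" if "t \<in> T" "n \<in> N0" for t n
    using N0E[OF that(2)] N0I[OF mult] that(1) by (auto simp: mat_mult_mat)
  ultimately have N0: "right_module N0 {}"
    unfolding right_module_def by auto
  have N1: "right_module (adjoin N0 x) {x}"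
    using right_module_adjoin[OF N0 det(1) tr(1)] by simp
  have N2: "right_module (adjoin (adjoin N0 x) y) {y, x}"
    using right_module_adjoin[OF N1 det(2) tr(2)] tr by auto
  have N3: "right_module N {z, y, x}"
    unfolding N_def by (rule right_module_adjoin[OF N2 det(3) tr(3)]) (use tr in auto)
  \<comment> \<open>\<open>tr0\<close>, \<open>tr1\<close> and \<open>tr2\<close> treat the
    successive layers: traces against \<open>w\<close> reduce to traces of \<open>w\<close> preceded
    by an ordered word in the letters adjoined so far. The final test word is the identity.\<close>
  have tr0: "(\<lambda>p. trace (n p ** w p)) \<in> T" if "n \<in> N0" "(\<lambda>p. trace (w p)) \<in> T" for n w
    using N0E[OF that(1)] mult[OF _ that(2)] by (auto simp: trace_mat_mult)
  have tr1: "(\<lambda>p. trace (n p ** w p)) \<in> T"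
    if "n \<in> adjoin N0 x" "(\<lambda>p. trace (w p)) \<in> T" "(\<lambda>p. trace (x p ** w p)) \<in> T" for n w
    by (rule trace_adjoin[OF _ _ that(1)]) (use that tr0 in auto)
  have tr2: "(\<lambda>p. trace (n p ** w p)) \<in> T"
    if "n \<in> adjoin (adjoin N0 x) y" "(\<lambda>p. trace (w p)) \<in> T" "(\<lambda>p. trace (x p ** w p)) \<in> T"
      "(\<lambda>p. trace (y p ** w p)) \<in> T" "(\<lambda>p. trace (x p ** (y p ** w p))) \<in> T" for n w
    by (rule trace_adjoin[OF _ _ that(1)]) (use that tr1 in auto)
  have "(\<lambda>p. trace (n p ** mat 1)) \<in> T" if "n \<in> N" for n
    by (rule trace_adjoin[OF _ _ that[unfolded N_def]]; rule tr2)
      (use tr const in \<open>simp_all add: matrix_mul_assoc trace_I\<close>)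
  then have "\<And>n. n \<in> N \<Longrightarrow> (\<lambda>p. trace (n p)) \<in> T"
    by simp
  moreover have "(\<lambda>p. mat 1) \<in> N"
    unfolding N_def using N0I[OF const[of 1]]
    by (intro subsetD[OF adjoin_subset[OF N2]] subsetD[OF adjoin_subset[OF N1]]
        subsetD[OF adjoin_subset[OF N0]])
  moreover have "right_module N {x, y, z}"
    using N3 by (simp add: insert_commute)
  ultimately show thesis
    using that by blast
qed

end

lemma function_algebra_generated: "function_algebra (generated_algebra (S :: ('p \<Rightarrow> 'a::field) set))"
  by unfold_locales (auto intro: generated_algebra.intros)

section \<open>The generators in shear coordinates\<close>

text \<open>The value 0 at an orbifold point makes \<open>exp_shear\<close> equal to exp(Y_i) there
  and to exp(Y_i + P_i/2) at a hole, so both kinds of points share one matrix form.\<close>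

definition hole_perimeter :: "(3 \<Rightarrow> marked_point) \<Rightarrow> 3 \<Rightarrow> 'a::{banach, real_normed_field} coords \<Rightarrow> 'a" where
  "hole_perimeter c i p = (case c i of Hole \<Rightarrow> of_real (snd p $ i) | Orbifold k \<Rightarrow> 0)"

definition exp_shear :: "(3 \<Rightarrow> marked_point) \<Rightarrow> 3 \<Rightarrow> 'a::{banach, real_normed_field} coords \<Rightarrow> 'a" where
  "exp_shear c i p = exp (fst p $ i + hole_perimeter c i p / 2)"

definition point_trace :: "(3 \<Rightarrow> marked_point) \<Rightarrow> 3 \<Rightarrow> 'a::{banach, real_normed_field} coords \<Rightarrow> 'a" where
  "point_trace c i p = (case c i of
     Hole \<Rightarrow> exp (hole_perimeter c i p / 2) + exp (- hole_perimeter c i p / 2)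
   | Orbifold k \<Rightarrow> of_real (2 * cos (pi / real k)))"

lemma exp_shear_nonzero [simp]: "exp_shear c i p \<noteq> 0"
  by (simp add: exp_shear_def)

lemma B_mat_eq:
  "B_mat c i p =
    mat2 0 (- exp_shear c i p) (inverse (exp_shear c i p)) (- point_trace c i p)"
proof -
  have split: "exp (y + z) = exp (y / 2) * exp (y / 2) * exp z" for y z :: 'a
    by (simp flip: exp_add)
  have minus: "exp (- z / 2) = inverse (exp (z / 2))" for z :: 'a
    by (simp add: exp_minus)
  show ?thesis
    by (cases "c i")
      (simp_all only: B_mat_def exp_shear_def point_trace_def hole_perimeter_def X_mat_def R_mat_def
        F_mat_def mat2_mult split minus marked_point.case,
       simp_all add: mat2_eq_iff field_simps)
qed

section \<open>Explicit generators and their trace functions\<close>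

lemma gamma_1: "\<gamma> c 1 p =
    mat2 0 (- exp_shear c 1 p) (inverse (exp_shear c 1 p)) (- point_trace c 1 p)"
  by (simp add: \<gamma>_def B_mat_eq)

lemma gamma_2: "\<gamma> c 2 p =
    mat2 (- exp_shear c 2 p - point_trace c 2 p)
      (- (exp_shear c 2 p + inverse (exp_shear c 2 p) + point_trace c 2 p))
      (exp_shear c 2 p) (exp_shear c 2 p)"
  by (simp add: \<gamma>_def B_mat_eq R_mat_def L_mat_def mat2_mult mat2_uminus mat2_eq_iff)

lemma gamma_3: "\<gamma> c 3 p =
    mat2 (- inverse (exp_shear c 3 p) - point_trace c 3 p) (- inverse (exp_shear c 3 p))
      (exp_shear c 3 p + inverse (exp_shear c 3 p) + point_trace c 3 p) (inverse (exp_shear c 3 p))"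
  by (simp add: \<gamma>_def B_mat_eq R_mat_def L_mat_def mat2_mult mat2_uminus mat2_eq_iff)

lemma det_gamma: "det (\<gamma> c i p) = 1"
  using exhaust_3[of i] by (auto simp: gamma_1 gamma_2 gamma_3 det_mat2 field_simps)

text \<open>Since \<open>R_mat ** L_mat\<close> and \<open>L_mat ** R_mat\<close> are minus the
  identity, \<open>\<gamma> c 2\<close> and \<open>\<gamma> c 3\<close> are conjugates of
  \<open>B_mat c 2\<close> and \<open>B_mat c 3\<close>, with the same traces.\<close>

lemma G_pt_eq: "G_pt c i p = point_trace c i p"
  using exhaust_3[of i] by (auto simp: G_pt_def gamma_1 gamma_2 gamma_3 trace_mat2)

lemma G_pair_12: "G_pair c 1 2 p =
    exp_shear c 1 p * exp_shear c 2 p + inverse (exp_shear c 1 p) * exp_shear c 2 p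
    + inverse (exp_shear c 1 p) * inverse (exp_shear c 2 p)
    + point_trace c 2 p * inverse (exp_shear c 1 p)
    + point_trace c 1 p * exp_shear c 2 p"
  by (simp add: G_pair_def gamma_1 gamma_2 mat2_mult trace_mat2 algebra_simps)

lemma G_pair_13: "G_pair c 1 3 p =
    exp_shear c 1 p * exp_shear c 3 p + exp_shear c 1 p * inverse (exp_shear c 3 p)
    + inverse (exp_shear c 1 p) * inverse (exp_shear c 3 p)
    + point_trace c 3 p * exp_shear c 1 p
    + point_trace c 1 p * inverse (exp_shear c 3 p)"
  by (simp add: G_pair_def gamma_1 gamma_3 mat2_mult trace_mat2 algebra_simps)

lemma G_pair_23: "G_pair c 2 3 p =
    exp_shear c 2 p * exp_shear c 3 p + inverse (exp_shear c 2 p) * exp_shear c 3 p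
    + inverse (exp_shear c 2 p) * inverse (exp_shear c 3 p)
    + point_trace c 3 p * inverse (exp_shear c 2 p)
    + point_trace c 2 p * exp_shear c 3 p"
  by (simp add: G_pair_def gamma_2 gamma_3 mat2_mult trace_mat2) (simp add: field_simps)

text \<open>The product of the three generators is lower triangular with diagonal entries -a1 a2 a3
  and -1/(a1 a2 a3), where ai stands for \<open>exp_shear c i p\<close>; hence no
  \<open>point_trace\<close> survives in its trace.\<close>

lemma G_inf_eq: "G_inf c p = exp_shear c 1 p * exp_shear c 2 p * exp_shear c 3 p
    + inverse (exp_shear c 1 p * exp_shear c 2 p * exp_shear c 3 p)"
  by (simp add: G_inf_def gamma_1 gamma_2 gamma_3 mat2_mult trace_mat2) (simp add: field_simps)

section \<open>Derivations along the shear coordinates\<close>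

text \<open>The derivatives along all directions of \<open>'a^3\<close>, with parameter in \<open>'a\<close>; this is enough for
  the chain rule along lines in a level set of \<open>G_inf\<close>.\<close>

definition has_gradient ::
  "('a::{banach, real_normed_field} coords \<Rightarrow> 'a) \<Rightarrow> 'a^3 \<Rightarrow> 'a coords \<Rightarrow> bool" where
  "has_gradient f d p \<longleftrightarrow> (\<forall>v. ((\<lambda>t. f (fst p + t *s v, snd p)) has_field_derivative
      (d $ 1 * v $ 1 + d $ 2 * v $ 2 + d $ 3 * v $ 3)) (at 0))"

lemma has_gradient_const: "has_gradient (\<lambda>p. k) 0 p"
  by (simp add: has_gradient_def)

lemma has_gradient_add:
  assumes "has_gradient f d p" "has_gradient g e p"
  shows "has_gradient (\<lambda>p. f p + g p) (d + e) p"
  unfolding has_gradient_def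
proof
  fix v :: "'a^3"
  show "((\<lambda>t. f (fst p + t *s v, snd p) + g (fst p + t *s v, snd p)) has_field_derivative
      (d + e) $ 1 * v $ 1 + (d + e) $ 2 * v $ 2 + (d + e) $ 3 * v $ 3) (at 0)"
    by (rule DERIV_cong, (rule DERIV_add assms[unfolded has_gradient_def, rule_format])+)
      (simp add: algebra_simps)
qed

lemma has_gradient_mult:
  assumes "has_gradient f d p" "has_gradient g e p"
  shows "has_gradient (\<lambda>p. f p * g p) (g p *s d + f p *s e) p"
  unfolding has_gradient_def
proof
  fix v :: "'a^3"
  show "((\<lambda>t. f (fst p + t *s v, snd p) * g (fst p + t *s v, snd p)) has_field_derivative
      (g p *s d + f p *s e) $ 1 * v $ 1 + (g p *s d + f p *s e) $ 2 * v $ 2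
      + (g p *s d + f p *s e) $ 3 * v $ 3) (at 0)"
    by (rule DERIV_cong, (rule DERIV_mult assms[unfolded has_gradient_def, rule_format])+)
      (simp add: algebra_simps)
qed

lemma partial_Y_has_gradient:
  assumes "has_gradient f d p"
  shows "partial_Y i f p = d $ i"
proof -
  let ?F = "\<lambda>t. f (\<chi> l. if l = i then t else fst p $ l, snd p)"
  have line: "(\<chi> l. if l = i then t + fst p $ i else fst p $ l) = fst p + t *s axis i 1" for t
    by (simp add: vec_eq_iff axis_def)
  have "((\<lambda>t. f (fst p + t *s axis i 1, snd p)) has_field_derivative d $ i) (at 0)"
    using assms[unfolded has_gradient_def, rule_format, of "axis i 1"] exhaust_3[of i]
    by (auto simp: axis_def)
  then have "((\<lambda>t. ?F (t + fst p $ i)) has_field_derivative d $ i) (at 0)"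
    by (simp only: line)
  then have "(?F has_field_derivative d $ i) (at (fst p $ i))"
    using DERIV_shift[of ?F "d $ i" 0 "fst p $ i"] by simp
  then show ?thesis
    unfolding partial_Y_def by (rule DERIV_imp_deriv)
qed

section \<open>The bracket in terms of gradients\<close>

lemma poisson_has_gradient:
  assumes "has_gradient f d p" "has_gradient g e p"
  shows "poisson f g p =
    (d $ 1 * e $ 2 - d $ 2 * e $ 1) + (d $ 2 * e $ 3 - d $ 3 * e $ 2) + (d $ 3 * e $ 1 - d $ 1 * e $ 3)"
  by (simp add: poisson_def assms[THEN partial_Y_has_gradient])

lemma poisson_swap: "poisson g f p = - poisson f g p"
  by (simp add: poisson_def algebra_simps)

lemma poisson_const: "poisson (\<lambda>p. k) g p = 0"
  by (simp add: poisson_def partial_Y_has_gradient[OF has_gradient_const])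

lemma poisson_add:
  assumes "has_gradient f d p" "has_gradient f' d' p"
  shows "poisson (\<lambda>p. f p + f' p) g p = poisson f g p + poisson f' g p"
  by (simp add: poisson_def partial_Y_has_gradient[OF has_gradient_add[OF assms]]
      assms[THEN partial_Y_has_gradient] algebra_simps)

lemma poisson_mult:
  assumes "has_gradient f d p" "has_gradient f' d' p"
  shows "poisson (\<lambda>p. f p * f' p) g p = f' p * poisson f g p + f p * poisson f' g p"
  by (simp add: poisson_def partial_Y_has_gradient[OF has_gradient_mult[OF assms]]
      assms[THEN partial_Y_has_gradient] algebra_simps)

lemma generated_algebra_has_gradient:
  assumes "f \<in> generated_algebra S" "\<And>s. s \<in> S \<Longrightarrow> \<exists>d. has_gradient s d p"
  shows "\<exists>d. has_gradient f d p"
  using assms(1)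
proof induction
  case (const a)
  show ?case by (rule exI) (rule has_gradient_const)
next
  case (base f)
  then show ?case by (rule assms(2))
next
  case (add f g)
  then show ?case by (elim exE) (rule exI, rule has_gradient_add)
next
  case (mult f g)
  then show ?case by (elim exE) (rule exI, rule has_gradient_mult)
qed

text \<open>The Leibniz rule reduces the first argument to generators, antisymmetry exchanges the
  arguments, and a second reduction treats the other one. Gradients of the generators guarantee
  differentiability of all sums and products.\<close>

lemma poisson_generated_algebra:
  fixes S :: "('a::{banach, real_normed_field} coords \<Rightarrow> 'a) set"
  assumes grad: "\<And>s p. s \<in> S \<Longrightarrow> \<exists>d. has_gradient s d p"
    and S: "\<And>s t. s \<in> S \<Longrightarrow> t \<in> S \<Longrightarrow> poisson s t \<in> generated_algebra S"
    and f: "f \<in> generated_algebra S" and g: "g \<in> generated_algebra S"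
  shows "poisson f g \<in> generated_algebra S"
proof -
  interpret function_algebra "generated_algebra S"
    by (rule function_algebra_generated)
  have left: "poisson f h \<in> generated_algebra S"
    if f: "f \<in> generated_algebra S" and h: "\<And>s. s \<in> S \<Longrightarrow> poisson s h \<in> generated_algebra S"
    for f h
    using f
  proof induction
    case (const a)
    then show ?case
      using generated_algebra.const[of 0 S] by (simp add: poisson_const[abs_def])
  next
    case (base f)
    then show ?case by (rule h)
  next
    case (add f f')
    have "poisson (\<lambda>p. f p + f' p) h = (\<lambda>p. poisson f h p + poisson f' h p)"
    proof
      fix p
      obtain d d' where "has_gradient f d p" "has_gradient f' d' p"
        using generated_algebra_has_gradient[OF _ grad] add.hyps by meson
      then show "poisson (\<lambda>p. f p + f' p) h p = poisson f h p + poisson f' h p"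
        by (rule poisson_add)
    qed
    then show ?case
      using generated_algebra.add[OF add.IH] by simp
  next
    case (mult f f')
    have "poisson (\<lambda>p. f p * f' p) h = (\<lambda>p. f' p * poisson f h p + f p * poisson f' h p)"
    proof
      fix p
      obtain d d' where "has_gradient f d p" "has_gradient f' d' p"
        using generated_algebra_has_gradient[OF _ grad] mult.hyps by meson
      then show "poisson (\<lambda>p. f p * f' p) h p = f' p * poisson f h p + f p * poisson f' h p"
        by (rule poisson_mult)
    qed
    then show ?case
      using generated_algebra.add[OF generated_algebra.mult[OF mult.hyps(2) mult.IH(1)]
          generated_algebra.mult[OF mult.hyps(1) mult.IH(2)]] by simp
  qed
  have swap: "poisson k h \<in> generated_algebra S" if "poisson h k \<in> generated_algebra S" for h k
    using uminus[OF that] by (simp add: poisson_swap[of h k, abs_def])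
  show ?thesis
  proof (rule left[OF f])
    fix s assume s: "s \<in> S"
    have "poisson g s \<in> generated_algebra S"
      by (rule left[OF g]) (rule S[OF _ s])
    then show "poisson s g \<in> generated_algebra S"
      by (rule swap)
  qed
qed

text \<open>The bivector is (D1 - D3) wedge (D2 - D3), with Di the derivative along Y_i, so the
  bracket is determined by derivatives in directions with coordinate sum 0.\<close>

lemma poisson_cong_on_lines:
  assumes f: "has_gradient f d p" "has_gradient f' d' p"
    and g: "has_gradient g e p" "has_gradient g' e' p"
    and eq: "\<And>v t. v $ 1 + v $ 2 + v $ 3 = 0 \<Longrightarrow>
      f (fst p + t *s v, snd p) = f' (fst p + t *s v, snd p) \<and>
      g (fst p + t *s v, snd p) = g' (fst p + t *s v, snd p)"
  shows "poisson f g p = poisson f' g' p"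
proof -
  have diff: "d $ 1 - d $ 3 = d' $ 1 - d' $ 3" "d $ 2 - d $ 3 = d' $ 2 - d' $ 3"
    if "has_gradient f d p" "has_gradient f' d' p"
      and eq: "\<And>v t. v $ 1 + v $ 2 + v $ 3 = 0 \<Longrightarrow>
        f (fst p + t *s v, snd p) = f' (fst p + t *s v, snd p)"
    for f f' :: "'a coords \<Rightarrow> 'a" and d d'
  proof -
    have *: "d $ 1 * v $ 1 + d $ 2 * v $ 2 + d $ 3 * v $ 3 =
      d' $ 1 * v $ 1 + d' $ 2 * v $ 2 + d' $ 3 * v $ 3"
      if "v $ 1 + v $ 2 + v $ 3 = 0" for v :: "'a^3"
    proof (rule DERIV_unique)
      let ?F = "\<lambda>t. f (fst p + t *s v, snd p)"
      show "(?F has_field_derivative d $ 1 * v $ 1 + d $ 2 * v $ 2 + d $ 3 * v $ 3) (at 0)"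
        using \<open>has_gradient f d p\<close> unfolding has_gradient_def by (rule spec)
      have "?F = (\<lambda>t. f' (fst p + t *s v, snd p))"
        using eq[OF that] by (rule ext)
      then show "(?F has_field_derivative d' $ 1 * v $ 1 + d' $ 2 * v $ 2 + d' $ 3 * v $ 3) (at 0)"
        using \<open>has_gradient f' d' p\<close> unfolding has_gradient_def by simp
    qed
    \<comment> \<open>The directions (1,0,-1) and (0,1,-1) have coordinate sum 0 and pick out
      exactly these differences.\<close>
    show "d $ 1 - d $ 3 = d' $ 1 - d' $ 3" "d $ 2 - d $ 3 = d' $ 2 - d' $ 3"
      using *[of "vector [1, 0, - 1]"] *[of "vector [0, 1, - 1]"] by simp_all
  qed
  have poisson_differences:
    "(d $ 1 * e $ 2 - d $ 2 * e $ 1) + (d $ 2 * e $ 3 - d $ 3 * e $ 2) + (d $ 3 * e $ 1 - d $ 1 * e $ 3)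
      = (d $ 1 - d $ 3) * (e $ 2 - e $ 3) - (d $ 2 - d $ 3) * (e $ 1 - e $ 3)" for d e :: "'a^3"
    by (simp add: algebra_simps)
  have g_diff: "e $ 1 - e $ 3 = e' $ 1 - e' $ 3" "e $ 2 - e $ 3 = e' $ 2 - e' $ 3"
    by (rule diff[OF g conjunct2[OF eq]], assumption)+
  have f_diff: "d $ 1 - d $ 3 = d' $ 1 - d' $ 3" "d $ 2 - d $ 3 = d' $ 2 - d' $ 3"
    by (rule diff[OF f conjunct1[OF eq]], assumption)+
  show ?thesis
    unfolding poisson_has_gradient[OF f(1) g(1)] poisson_has_gradient[OF f(2) g(2)]
      poisson_differences
    by (simp only: f_diff g_diff)
qed

section \<open>Geodesic functions\<close>

lemma hole_perimeter_snd: "hole_perimeter c i (y, snd p) = hole_perimeter c i p"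
  by (cases "c i") (simp_all add: hole_perimeter_def)

lemma exp_shear_shift:
  "exp_shear c i (fst p + t *s v, snd p) = exp_shear c i p * exp (t * v $ i)"
  by (simp add: exp_shear_def hole_perimeter_snd algebra_simps flip: exp_add)

lemma point_trace_shift: "point_trace c i (y, snd p) = point_trace c i p"
  by (simp add: point_trace_def hole_perimeter_snd cong: marked_point.case_cong)

lemma exp_shear_shift_DERIV:
  "((\<lambda>t. exp_shear c i (fst p + t *s v, snd p)) has_field_derivative exp_shear c i p * v $ i) (at 0)"
  unfolding exp_shear_shift by (auto intro!: derivative_eq_intros)

lemma inverse_exp_shear_shift_DERIV:
  "((\<lambda>t. inverse (exp_shear c i (fst p + t *s v, snd p))) has_field_derivative
    - (inverse (exp_shear c i p) * v $ i)) (at 0)"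
  unfolding exp_shear_shift by (auto intro!: derivative_eq_intros simp: field_simps)

lemma has_gradient_exp_shear:
  "has_gradient (exp_shear c i) (axis i (exp_shear c i p)) p"
  using exhaust_3[of i] exp_shear_shift_DERIV[of c i p] by (auto simp: has_gradient_def axis_def)

lemma has_gradient_inverse_exp_shear:
  "has_gradient (\<lambda>p. inverse (exp_shear c i p)) (axis i (- inverse (exp_shear c i p))) p"
  using exhaust_3[of i] inverse_exp_shear_shift_DERIV[of c i p]
  by (auto simp: has_gradient_def axis_def)

lemma has_gradient_point_trace: "has_gradient (point_trace c i) 0 p"
  by (simp add: has_gradient_def point_trace_shift)

lemmas has_gradient_intros = has_gradient_add has_gradient_mult has_gradient_exp_shear
  has_gradient_inverse_exp_shear has_gradient_point_trace

lemma has_gradient_cong: "has_gradient f d p \<Longrightarrow> d = d' \<Longrightarrow> has_gradient f d' p"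
  by simp

lemma vector_3_eq_iff: "(v :: 'a::zero^3) = vector [x, y, z] \<longleftrightarrow> v $ 1 = x \<and> v $ 2 = y \<and> v $ 3 = z"
  by (simp add: vec_eq_iff forall_3 vector_3)

lemma has_gradient_G_pt: "has_gradient (G_pt c i) 0 p"
  using has_gradient_point_trace by (simp add: G_pt_eq[abs_def])

text \<open>\<open>G_inf\<close> depends on the shear coordinates only through their sum, so its
  gradient is a multiple of (1,1,1); this is what makes it central.\<close>

lemma has_gradient_G_inf:
  "has_gradient (G_inf c) (vec (exp_shear c 1 p * exp_shear c 2 p * exp_shear c 3 p
    - inverse (exp_shear c 1 p * exp_shear c 2 p * exp_shear c 3 p))) p"
  unfolding G_inf_eq[abs_def] inverse_mult_distrib
  by (rule has_gradient_cong, (rule has_gradient_intros)+)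
    (simp add: vec_eq_iff forall_3 axis_def algebra_simps)

text \<open>Differentiating along Y_i multiplies each Laurent monomial by its exponent in
  \<open>exp_shear c i\<close>; the zero entry belongs to the coordinate that does not
  occur.\<close>

lemma has_gradient_G_pair:
  shows has_gradient_G_12: "has_gradient (G_pair c 1 2) (vector
    [exp_shear c 1 p * exp_shear c 2 p - inverse (exp_shear c 1 p) * exp_shear c 2 p
      - inverse (exp_shear c 1 p) * inverse (exp_shear c 2 p)
      - point_trace c 2 p * inverse (exp_shear c 1 p),
     exp_shear c 1 p * exp_shear c 2 p + inverse (exp_shear c 1 p) * exp_shear c 2 p
      - inverse (exp_shear c 1 p) * inverse (exp_shear c 2 p) + point_trace c 1 p * exp_shear c 2 p,
     0]) p"
  and has_gradient_G_13: "has_gradient (G_pair c 1 3) (vector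
    [exp_shear c 1 p * exp_shear c 3 p + exp_shear c 1 p * inverse (exp_shear c 3 p)
      - inverse (exp_shear c 1 p) * inverse (exp_shear c 3 p) + point_trace c 3 p * exp_shear c 1 p,
     0,
     exp_shear c 1 p * exp_shear c 3 p - exp_shear c 1 p * inverse (exp_shear c 3 p)
      - inverse (exp_shear c 1 p) * inverse (exp_shear c 3 p)
      - point_trace c 1 p * inverse (exp_shear c 3 p)]) p"
  and has_gradient_G_23: "has_gradient (G_pair c 2 3) (vector
    [0,
     exp_shear c 2 p * exp_shear c 3 p - inverse (exp_shear c 2 p) * exp_shear c 3 p
      - inverse (exp_shear c 2 p) * inverse (exp_shear c 3 p)
      - point_trace c 3 p * inverse (exp_shear c 2 p),
     exp_shear c 2 p * exp_shear c 3 p + inverse (exp_shear c 2 p) * exp_shear c 3 p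
      - inverse (exp_shear c 2 p) * inverse (exp_shear c 3 p) + point_trace c 2 p * exp_shear c 3 p]) p"
  unfolding G_pair_12[abs_def] G_pair_13[abs_def] G_pair_23[abs_def]
  by (rule has_gradient_cong, (rule has_gradient_intros)+,
      simp add: vector_3_eq_iff axis_def algebra_simps)+

lemma poisson_G_pair:
  shows poisson_G_12_23: "poisson (G_pair c 1 2) (G_pair c 2 3) p =
      G_pair c 1 2 p * G_pair c 2 3 p - 2 * G_pair c 1 3 p - \<omega> c 1 3 2 p"
    and poisson_G_23_13: "poisson (G_pair c 2 3) (G_pair c 1 3) p =
      G_pair c 2 3 p * G_pair c 1 3 p - 2 * G_pair c 1 2 p - \<omega> c 1 2 3 p"
    and poisson_G_13_12: "poisson (G_pair c 1 3) (G_pair c 1 2) p =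
      G_pair c 1 2 p * G_pair c 1 3 p - 2 * G_pair c 2 3 p - \<omega> c 2 3 1 p"
proof -
  define a1 a2 a3 where "a1 = exp_shear c 1 p" "a2 = exp_shear c 2 p" "a3 = exp_shear c 3 p"
  note a = this[symmetric]
  have nz: "a1 \<noteq> 0" "a2 \<noteq> 0" "a3 \<noteq> 0"
    by (simp_all flip: a)
  \<comment> \<open>Treating the inverses as new variables with relations ai bi = 1 turns each
    bracket formula into a polynomial identity modulo these relations, which \<open>algebra\<close>
    can settle.\<close>
  define b1 b2 b3 where "b1 = inverse a1" "b2 = inverse a2" "b3 = inverse a3"
  note b = this[symmetric]
  have ab: "a1 * b1 = 1" "a2 * b2 = 1" "a3 * b3 = 1"
    using nz by (simp_all flip: b)
  note eqs = G_pair_12 G_pair_13 G_pair_23 G_inf_eq G_pt_eq \<omega>_def a inverse_mult_distrib b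
  show "poisson (G_pair c 1 2) (G_pair c 2 3) p =
      G_pair c 1 2 p * G_pair c 2 3 p - 2 * G_pair c 1 3 p - \<omega> c 1 3 2 p"
    unfolding poisson_has_gradient[OF has_gradient_G_12 has_gradient_G_23] vector_3 eqs
    using ab by algebra
  show "poisson (G_pair c 2 3) (G_pair c 1 3) p =
      G_pair c 2 3 p * G_pair c 1 3 p - 2 * G_pair c 1 2 p - \<omega> c 1 2 3 p"
    unfolding poisson_has_gradient[OF has_gradient_G_23 has_gradient_G_13] vector_3 eqs
    using ab by algebra
  show "poisson (G_pair c 1 3) (G_pair c 1 2) p =
      G_pair c 1 2 p * G_pair c 1 3 p - 2 * G_pair c 2 3 p - \<omega> c 2 3 1 p"
    unfolding poisson_has_gradient[OF has_gradient_G_13 has_gradient_G_12] vector_3 eqs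
    using ab by algebra
qed

section \<open>Generation by the seven functions\<close>

definition geodesic_generators ::
  "(3 \<Rightarrow> marked_point) \<Rightarrow> ('a::{banach, real_normed_field} coords \<Rightarrow> 'a) set" where
  "geodesic_generators c =
    {G_pt c 1, G_pt c 2, G_pt c 3, G_inf c} \<union> {G_pair c 1 2, G_pair c 1 3, G_pair c 2 3}"

text \<open>Right multiplication by any group element preserves the module spanned by the ordered
  words. Applied to the identity, this puts the element itself into the module, where all traces are
  polynomials in the seven generators.\<close>

lemma trace_fuchsian_group:
  fixes h :: "'a::{banach, real_normed_field} coords \<Rightarrow> 'a^2^2"
  assumes "h \<in> fuchsian_group c"
  shows "(\<lambda>p. trace (h p)) \<in> generated_algebra (geodesic_generators c)"
proof -
  let ?T = "generated_algebra (geodesic_generators c :: ('a coords \<Rightarrow> 'a) set)"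
  interpret function_algebra ?T
    by (rule function_algebra_generated)
  have neg: "(\<lambda>p. - f p) \<in> ?T" if "f \<in> geodesic_generators c" for f
    using uminus[OF generated_algebra.base[OF that]] .
  have tr: "(\<lambda>p. trace (\<gamma> c 1 p)) \<in> ?T" "(\<lambda>p. trace (\<gamma> c 2 p)) \<in> ?T" "(\<lambda>p. trace (\<gamma> c 3 p)) \<in> ?T"
    "(\<lambda>p. trace (\<gamma> c 1 p ** \<gamma> c 2 p)) \<in> ?T" "(\<lambda>p. trace (\<gamma> c 1 p ** \<gamma> c 3 p)) \<in> ?T"
    "(\<lambda>p. trace (\<gamma> c 2 p ** \<gamma> c 3 p)) \<in> ?T" "(\<lambda>p. trace (\<gamma> c 1 p ** \<gamma> c 2 p ** \<gamma> c 3 p)) \<in> ?T"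
    using neg[of "G_pt c 1"] neg[of "G_pt c 2"] neg[of "G_pt c 3"] neg[of "G_pair c 1 2"]
      neg[of "G_pair c 1 3"] neg[of "G_pair c 2 3"] neg[of "G_inf c"]
    by (simp_all add: geodesic_generators_def G_pt_def G_pair_def G_inf_def)
  obtain N where N: "right_module N {\<gamma> c 1, \<gamma> c 2, \<gamma> c 3}" and one: "(\<lambda>p. mat 1) \<in> N"
    and trN: "\<And>n. n \<in> N \<Longrightarrow> (\<lambda>p. trace (n p)) \<in> ?T"
    by (rule exists_trace_module[OF det_gamma det_gamma det_gamma tr]) (rule that; assumption)
  have trace: "(\<lambda>p. trace (k p)) \<in> ?T" if "\<And>n. n \<in> N \<Longrightarrow> (\<lambda>p. n p ** k p) \<in> N" for k
    using trN[OF that[OF one]] by simp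
  \<comment> \<open>The determinant is carried along because the inverse case rests on
    \<open>matrix_inv_unimodular_2\<close>; the trace that appears there as a scalar is supplied by
    stability, through \<open>trace\<close>.\<close>
  have "(\<forall>p. det (h p) = 1) \<and> (\<forall>n\<in>N. (\<lambda>p. n p ** h p) \<in> N)"
    using assms
  proof induction
    case one
    then show ?case by simp
  next
    case (generator i)
    have "\<gamma> c i \<in> {\<gamma> c 1, \<gamma> c 2, \<gamma> c 3}"
      using exhaust_3[of i] by blast
    then show ?case
      by (intro conjI allI ballI det_gamma right_moduleD(3)[OF N])
  next
    case (inverse k)
    have det: "det (k p) = 1" for p
      using inverse.IH by blast
    have k: "(\<lambda>p. n p ** k p) \<in> N" if "n \<in> N" for n
      using inverse.IH that by blast
    note inv = matrix_inv_unimodular_2[OF det]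
    have "det (matrix_inv (k p)) = 1" for p
      by (rule det_matrix_inv_unimodular_2[OF det])
    moreover have "(\<lambda>p. n p ** matrix_inv (k p)) \<in> N" if n: "n \<in> N" for n
    proof -
      have "n p ** matrix_inv (k p) = mat (trace (k p)) ** n p + mat (- 1) ** (n p ** k p)" for p
        by (simp only: inv matrix_add_ldistrib mat_commute[of "n p"] matrix_mul_assoc)
      then show ?thesis
        using right_moduleD(1)[OF N right_moduleD(2)[OF N trace[OF k] n]
            right_moduleD(2)[OF N const[of "- 1"] k[OF n]]] by simp
    qed
    ultimately show ?case by simp
  next
    case (mult k l)
    have "(\<lambda>p. n p ** k p ** l p) \<in> N" if "n \<in> N" for n
      using mult.IH that by simp
    then show ?case
      using mult.IH by (simp add: det_mul matrix_mul_assoc)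
  qed
  then show ?thesis
    by (intro trace) simp
qed

text \<open>One inclusion is the reduction of traces of arbitrary group elements; conversely, each
  of the seven generators is minus the trace of a word of length at most three.\<close>

lemma geodesic_functions_eq:
  "(geodesic_functions c :: ('a::{banach, real_normed_field} coords \<Rightarrow> 'a) set) =
    generated_algebra (geodesic_generators c)"
proof
  interpret function_algebra "generated_algebra (geodesic_generators c :: ('a coords \<Rightarrow> 'a) set)"
    by (rule function_algebra_generated)
  show "geodesic_functions c \<subseteq> generated_algebra (geodesic_generators c :: ('a coords \<Rightarrow> 'a) set)"
    unfolding geodesic_functions_def
    by (rule generated_algebra_subset) (auto simp only: trace_fuchsian_group)
next
  interpret function_algebra "geodesic_functions c :: ('a coords \<Rightarrow> 'a) set"
    unfolding geodesic_functions_def by (rule function_algebra_generated)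
  have neg_trace: "(\<lambda>p. - trace (h p)) \<in> geodesic_functions c" if "h \<in> fuchsian_group c"
    for h :: "'a coords \<Rightarrow> 'a^2^2"
  proof (rule uminus)
    show "(\<lambda>p. trace (h p)) \<in> geodesic_functions c"
      unfolding geodesic_functions_def by (rule generated_algebra.base) (use that in auto)
  qed
  note neg_traces = neg_trace[OF fuchsian_group.generator]
    neg_trace[OF fuchsian_group.mult[OF fuchsian_group.generator fuchsian_group.generator]]
    neg_trace[OF fuchsian_group.mult[OF fuchsian_group.mult[OF
      fuchsian_group.generator fuchsian_group.generator] fuchsian_group.generator]]
  have "geodesic_generators c \<subseteq> (geodesic_functions c :: ('a coords \<Rightarrow> 'a) set)"
    by (simp add: geodesic_generators_def G_pt_def[abs_def] G_pair_def[abs_def] G_inf_def[abs_def]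
        neg_traces)
  then show "generated_algebra (geodesic_generators c) \<subseteq> (geodesic_functions c :: ('a coords \<Rightarrow> 'a) set)"
    by (rule generated_algebra_subset)
qed

lemma geodesic_functions_has_gradient:
  assumes "f \<in> geodesic_functions c"
  shows "\<exists>d. has_gradient f d p"
  using assms unfolding geodesic_functions_eq
  by (rule generated_algebra_has_gradient)
    (auto simp: geodesic_generators_def
      intro: has_gradient_G_pt has_gradient_G_inf has_gradient_G_pair)

section \<open>Central elements and closure under the bracket\<close>

text \<open>Gradients with three equal entries cancel in the cyclic sum defining the
  bracket.\<close>

lemma central_poisson:
  assumes z: "z \<in> {G_pt c 1, G_pt c 2, G_pt c 3, G_inf c}" and f: "has_gradient f d p"
  shows "poisson z f p = 0"
proof -
  have "has_gradient (G_pt c i) (vec 0) p" for i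
    using has_gradient_G_pt by simp
  then obtain k where "has_gradient z (vec k) p"
    using z has_gradient_G_inf[of c p] by blast
  from poisson_has_gradient[OF this f] show ?thesis
    by (simp add: algebra_simps)
qed

text \<open>By the Leibniz rule it suffices to treat generators: a bracket with a central one
  vanishes, and the explicit formulas together with antisymmetry cover the pair functions.\<close>

lemma poisson_geodesic_functions:
  fixes f g :: "'a::{banach, real_normed_field} coords \<Rightarrow> 'a"
  assumes "f \<in> geodesic_functions c" "g \<in> geodesic_functions c"
  shows "poisson f g \<in> geodesic_functions c"
proof -
  let ?S = "geodesic_generators c :: ('a coords \<Rightarrow> 'a) set"
  let ?A = "generated_algebra ?S"
  let ?C = "{G_pt c 1, G_pt c 2, G_pt c 3, G_inf c} :: ('a coords \<Rightarrow> 'a) set"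
  let ?P = "{G_pair c 1 2, G_pair c 1 3, G_pair c 2 3} :: ('a coords \<Rightarrow> 'a) set"
  interpret function_algebra ?A
    by (rule function_algebra_generated)
  have base: "s \<in> ?A" if "s \<in> ?S" for s
    using that by (rule generated_algebra.base)
  have grad: "\<exists>d. has_gradient s d p" if "s \<in> ?S" for s p
    by (rule geodesic_functions_has_gradient[unfolded geodesic_functions_eq, OF base[OF that]])
  have swap: "poisson t s \<in> ?A" if "poisson s t \<in> ?A" for s t
    using uminus[OF that] by (simp add: poisson_swap[of s t, abs_def])
  have central: "poisson z s \<in> ?A" if "z \<in> ?C" "s \<in> ?S" for z s
  proof -
    have "poisson z s = (\<lambda>p. 0)"
      by (rule ext) (rule exE[OF grad[OF that(2)]], erule central_poisson[OF that(1)])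
    then show ?thesis
      using const[of 0] by simp
  qed
  have self: "poisson s s \<in> ?A" for s
    using const[of 0] by (simp add: poisson_def[abs_def] mult.commute)
  have in_A: "G_pt c 1 \<in> ?A" "G_pt c 2 \<in> ?A" "G_pt c 3 \<in> ?A" "G_inf c \<in> ?A"
    "G_pair c 1 2 \<in> ?A" "G_pair c 1 3 \<in> ?A" "G_pair c 2 3 \<in> ?A"
    by (rule base, simp add: geodesic_generators_def)+
  have combine: "(\<lambda>p. u p * v p - 2 * w p - (x p * y p + z p * t p)) \<in> ?A"
    if "u \<in> ?A" "v \<in> ?A" "w \<in> ?A" "x \<in> ?A" "y \<in> ?A" "z \<in> ?A" "t \<in> ?A" for u v w x y z t
    by (rule diff[OF diff[OF mult[OF that(1,2)] mult[OF const that(3)]]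
          add[OF mult[OF that(4,5)] mult[OF that(6,7)]]])
  have pairs: "poisson (G_pair c 1 2) (G_pair c 2 3) \<in> ?A"
    "poisson (G_pair c 2 3) (G_pair c 1 3) \<in> ?A" "poisson (G_pair c 1 3) (G_pair c 1 2) \<in> ?A"
    unfolding poisson_G_pair[abs_def] \<omega>_def by (rule combine; rule in_A)+
  have generators: "poisson s t \<in> ?A" if s: "s \<in> ?S" and t: "t \<in> ?S" for s t
  proof -
    consider "s \<in> ?C" | "t \<in> ?C" | "s \<in> ?P" "t \<in> ?P"
      using s t unfolding geodesic_generators_def Un_iff by metis
    then show ?thesis
    proof cases
      case 1
      then show ?thesis using t by (rule central)
    next
      case 2
      show ?thesis by (rule swap, rule central[OF 2 s])
    next
      case 3
      then show ?thesis
        by (elim insertE emptyE) (simp_all only: self pairs pairs[THEN swap])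
    qed
  qed
  show ?thesis
    unfolding geodesic_functions_eq
    by (rule poisson_generated_algebra[OF grad generators assms[unfolded geodesic_functions_eq]])
qed

text \<open>\<open>G_inf c\<close> depends on \<open>Y\<close> only through \<open>Y\<^sub>1 + Y\<^sub>2 + Y\<^sub>3\<close>.\<close>

lemma phase_space_line:
  assumes p: "p \<in> phase_space c c_inf" and v: "v $ 1 + v $ 2 + v $ 3 = 0"
  shows "(fst p + t *s v, snd p) \<in> phase_space c c_inf"
proof -
  have "exp (t * v $ 1) * exp (t * v $ 2) * exp (t * v $ 3) = exp (t * (v $ 1 + v $ 2 + v $ 3))"
    by (simp only: distrib_left exp_add)
  then have exp_1: "exp (t * v $ 1) * exp (t * v $ 2) * exp (t * v $ 3) = 1"
    by (simp only: v mult_zero_right exp_zero)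
  have "exp_shear c 1 (fst p + t *s v, snd p) * exp_shear c 2 (fst p + t *s v, snd p)
      * exp_shear c 3 (fst p + t *s v, snd p) =
    exp_shear c 1 p * exp_shear c 2 p * exp_shear c 3 p
      * (exp (t * v $ 1) * exp (t * v $ 2) * exp (t * v $ 3))"
    by (simp only: exp_shear_shift ac_simps)
  then have "G_inf c (fst p + t *s v, snd p) = G_inf c p"
    by (simp only: G_inf_eq exp_1 mult_1_right)
  then show ?thesis
    using p by (auto simp: phase_space_def split: marked_point.splits)
qed

theorem corollary2p3:
  fixes c :: "3 \<Rightarrow> marked_point" and c_inf :: marked_point and j :: nat
    and D :: "('a::{banach, real_normed_field}) coords set"
    and A :: "('a coords \<Rightarrow> 'a) set"
  assumes "j \<in> {1, 2, 3, 4}"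
    and "num_orbifold c c_inf = j"
    and "\<forall>i. valid_point (c i)" and "valid_point c_inf"
    and "D = phase_space c c_inf"
    and "A = geodesic_functions c"
  shows
    "(\<forall>f\<in>A. \<forall>g\<in>A. restrict (poisson f g) D \<in> restrict_all D A) \<and>
     (\<forall>f\<in>A. \<forall>f'\<in>A. \<forall>g\<in>A. \<forall>g'\<in>A.
        restrict f D = restrict f' D \<longrightarrow> restrict g D = restrict g' D \<longrightarrow>
        restrict (poisson f g) D = restrict (poisson f' g') D) \<and>
     (\<forall>z \<in> {G_pt c 1, G_pt c 2, G_pt c 3, G_inf c}.
        z \<in> A \<and> (\<forall>f\<in>A. \<forall>p\<in>D. poisson z f p = 0)) \<and>
     restrict_all D A =
       restrict_all D (generated_algebra
         ({G_pt c 1, G_pt c 2, G_pt c 3, G_inf c} \<union> {G_pair c 1 2, G_pair c 1 3, G_pair c 2 3})) \<and>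
     (\<forall>p\<in>D.
        poisson (G_pair c 1 2) (G_pair c 2 3) p
          = G_pair c 1 2 p * G_pair c 2 3 p - 2 * G_pair c 1 3 p - \<omega> c 1 3 2 p \<and>
        poisson (G_pair c 2 3) (G_pair c 1 3) p
          = G_pair c 2 3 p * G_pair c 1 3 p - 2 * G_pair c 1 2 p - \<omega> c 1 2 3 p \<and>
        poisson (G_pair c 1 3) (G_pair c 1 2) p
          = G_pair c 1 2 p * G_pair c 1 3 p - 2 * G_pair c 2 3 p - \<omega> c 2 3 1 p)"
proof -
  have D: "D = phase_space c c_inf" and A: "A = geodesic_functions c"
    by fact+
  note grad = geodesic_functions_has_gradient[of _ c]
  have closed: "restrict (poisson f g) D \<in> restrict_all D A" if "f \<in> A" "g \<in> A" for f g
    using that poisson_geodesic_functions unfolding A restrict_all_def by blast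
  have well_defined: "restrict (poisson f g) D = restrict (poisson f' g') D"
    if mem: "f \<in> A" "f' \<in> A" "g \<in> A" "g' \<in> A"
      and f: "restrict f D = restrict f' D" and g: "restrict g D = restrict g' D" for f f' g g'
  proof (rule restrict_ext)
    fix p assume p: "p \<in> D"
    have eq: "f q = f' q" "g q = g' q" if "q \<in> D" for q
      using fun_cong[OF f, of q] fun_cong[OF g, of q] that by simp_all
    obtain d d' e e' where "has_gradient f d p" "has_gradient f' d' p"
      "has_gradient g e p" "has_gradient g' e' p"
      using grad mem unfolding A by meson
    \<comment> \<open>Lines through \<open>p\<close> whose direction has coordinate sum 0 stay in
      \<open>D\<close>, so functions with equal restrictions agree along them even when they differ
      off \<open>D\<close>.\<close>
    then show "poisson f g p = poisson f' g' p"
      by (rule poisson_cong_on_lines)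
        (intro conjI eq; unfold D; rule phase_space_line[OF p[unfolded D]])
  qed
  let ?C = "{G_pt c 1, G_pt c 2, G_pt c 3, G_inf c}"
  have mem: "z \<in> A" if "z \<in> ?C" for z
    unfolding A geodesic_functions_eq
    by (rule generated_algebra.base) (use that in \<open>auto simp: geodesic_generators_def\<close>)
  have central: "poisson z f p = 0" if "z \<in> ?C" "f \<in> A" for z f p
    using grad[of f p] that(2) central_poisson[OF that(1), of f _ p] unfolding A by blast
  have generators: "restrict_all D A = restrict_all D (generated_algebra
      (?C \<union> {G_pair c 1 2, G_pair c 1 3, G_pair c 2 3}))"
    unfolding A geodesic_functions_eq geodesic_generators_def ..
  show ?thesis
    by (intro conjI ballI impI;
        (rule closed mem generators poisson_G_pair | rule well_defined | rule central); assumption)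
qed

end
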